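(* Let $(\gamma_l)_{l\ge1}$ be any sequence of positive real numbers, going to zero as $l$ goes to infinity, such that the series $\sum_{l\ge1}\gamma_l^2$ is divergent, with $0<\gamma_l<1$ for each $l\ge1$. Let $(r_l)_{l\ge1}$ be a sequence of integers growing to infinity so slowly that the series $\sum_{l\ge1}\gamma_l^2/r_l$ is divergent, with $r_l\ge2$ for each $l\ge1$. Define a sequence $(p_l)_{l\ge1}$ of integers by setting $p_1=1$ and $p_{l+1}=[r_l^2/\gamma_l]\,p_l+1$ for $l\ge1$. Then for each $l\ge1$ we have $p_{l+1}>r_l\,p_l$. Define a strictly increasing sequence $(n_k)_{k\ge1}$ of integers by setting $$\{n_k : k\ge1\}=\bigcup_{l\ge1}\{p_l,\,2p_l,\,\dots,\,r_l\,p_l\}.$$ Then no continuous probability measure $\sigma$ on the unit circle $\mathbb{T}$ can be IP-Dirichlet with respect to the sequence $(n_k)_{k\ge1}$.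
   Context: $[x]$ denotes the integer part of the real number $x$. $\mathbb{T}=\{\lambda\in\mathbb{C}: |\lambda|=1\}$. For a Borel probability measure $\mu$ on $\mathbb{T}$ and $n\in\mathbb{Z}$, $\hat\mu(n)=\int_{\mathbb{T}}\lambda^n\,d\mu(\lambda)$. A measure is continuous if it has no atoms. Let $\mathcal{F}$ be the set of all non-empty finite subsets of $\mathbb{N}=\{1,2,\dots\}$. A probability measure $\mu$ on $\mathbb{T}$ is IP-Dirichlet with respect to $(n_k)_{k\ge1}$ if $\hat\mu(\sum_{k\in F}n_k)\to 1$ as $\min(F)\to+\infty$, $F\in\mathcal{F}$; that is, for every $\varepsilon>0$ there exists $k_0$ such that $|\hat\mu(\sum_{k\in F}n_k)-1|<\varepsilon$ for every $F\in\mathcal{F}$ with $\min(F)\ge k_0$. *)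

theory Defs
  imports "HOL-Analysis.Analysis" "HOL-Probability.Probability"
begin

abbreviation unit_circle :: "complex set" where
  "unit_circle \<equiv> sphere 0 1"

definition circle_prob :: "complex measure \<Rightarrow> bool" where
  "circle_prob \<mu> \<longleftrightarrow>
     prob_space \<mu> \<and> sets \<mu> = sets (restrict_space borel unit_circle)"

definition fourier_coeff :: "complex measure \<Rightarrow> int \<Rightarrow> complex" where
  "fourier_coeff \<mu> m = (LINT z|\<mu>. z powi m)"

(* An atom of a Borel measure on the circle is a point of positive mass. *)
definition continuous_measure :: "complex measure \<Rightarrow> bool" where
  "continuous_measure \<mu> \<longleftrightarrow> (\<forall>z\<in>space \<mu>. emeasure \<mu> {z} = 0)"

(* Sequences are indexed from 1: the value n 0 is never used. *)
definition IP_Dirichlet :: "complex measure \<Rightarrow> (nat \<Rightarrow> int) \<Rightarrow> bool" where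
  "IP_Dirichlet \<mu> n \<longleftrightarrow>
     (\<forall>\<epsilon>>0::real. \<exists>k0::nat. \<forall>F. finite F \<and> F \<noteq> {} \<and> F \<subseteq> {1..} \<and> k0 \<le> Min F \<longrightarrow>
        cmod (fourier_coeff \<mu> (\<Sum>k\<in>F. n k) - 1) < \<epsilon>)"

end

theory Submission
  imports Defs
begin

text \<open>
  Averaging the Fourier coefficients of an IP-Dirichlet measure \<open>\<sigma>\<close> at the sums
  \<open>\<Sum>k\<in>F. n k\<close> over all \<open>F \<subseteq> {k0..<K}\<close> shows that the integral of
  \<open>\<Prod>k\<in>{k0..<K}. \<bar>(1 + z powi n k) / 2\<bar>\<close> stays above \<open>1 / 2\<close>.  These products tend to \<open>0\<close> wherever
  \<open>\<Sum>k. \<bar>z powi n k - 1\<bar>\<^sup>2\<close> diverges, so if \<open>\<sigma>\<close> has no atom at \<open>1\<close>, the series converges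
  for some \<open>z \<noteq> 1\<close>.  Put \<open>\<delta> l = \<bar>z powi p l - 1\<bar>\<close>.  For large \<open>l\<close> all points \<open>z powi (j * p l)\<close> with
  \<open>j \<le> r l\<close> are close to \<open>1\<close>, hence \<open>\<bar>z powi (j * p l) - 1\<bar> \<ge> j / 2 * \<delta> l\<close> and the block of \<open>l\<close>
  contributes at least a constant times \<open>r l ^ 3 * (\<delta> l)\<^sup>2\<close>.  On the other hand the recursion for \<open>p\<close> gives
  \<open>\<bar>z - 1\<bar> \<le> \<delta> (l + 1) + (r l)\<^sup>2 / \<gamma> l * \<delta> l\<close>, so \<open>\<delta> l\<close> is at least a constant times
  \<open>\<gamma> l / (r l)\<^sup>2\<close>, and \<open>\<Sum>l. (\<gamma> l)\<^sup>2 / r l\<close> would converge.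
\<close>

section \<open>Elementary estimates for series and for powers of unimodular numbers\<close>

lemma not_summable_imp_filterlim_at_top:
  fixes f :: "nat \<Rightarrow> real"
  assumes "\<not> summable f" "\<And>n. 0 \<le> f n"
  shows "filterlim (\<lambda>N. \<Sum>k<N. f k) at_top sequentially"
  unfolding filterlim_at_top
proof
  fix B
  obtain N where "B < (\<Sum>k<N. f k)"
    using assms summableI_nonneg_bounded[of f B] by (metis not_le)
  moreover have "(\<Sum>k<N. f k) \<le> (\<Sum>k<M. f k)" if "N \<le> M" for M
    using that assms(2) by (intro sum_mono2) auto
  ultimately show "\<forall>\<^sub>F N in sequentially. B \<le> (\<Sum>k<N. f k)"
    unfolding eventually_sequentially by (meson less_imp_le order_trans)
qed

text \<open>By the parallelogram law the square of the left side is
  \<open>1 - (cmod (z - 1))\<^sup>2 / 4\<close>. Then \<open>1 + x \<le> exp x\<close> applies, and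
  the square root turns the 4 into 8.\<close>

lemma norm_one_plus_half_le_exp:
  fixes z :: complex
  assumes "cmod z = 1"
  shows "cmod ((1 + z) / 2) \<le> exp (- (cmod (z - 1))\<^sup>2 / 8)"
proof (rule power2_le_imp_le)
  have re: "(Re z)\<^sup>2 + (Im z)\<^sup>2 = 1"
    using assms by (metis cmod_power2 power_one)
  have "(cmod ((1 + z) / 2))\<^sup>2 = 1 - (cmod (z - 1))\<^sup>2 / 4"
    using re by (simp add: norm_divide power_divide cmod_power2) (simp add: power2_eq_square field_simps)
  also have "\<dots> \<le> exp (- (cmod (z - 1))\<^sup>2 / 4)"
    using exp_ge_add_one_self[of "- (cmod (z - 1))\<^sup>2 / 4"] by simp
  also have "\<dots> = (exp (- (cmod (z - 1))\<^sup>2 / 8))\<^sup>2"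
    by (simp add: power2_eq_square flip: exp_add)
  finally show "(cmod ((1 + z) / 2))\<^sup>2 \<le> (exp (- (cmod (z - 1))\<^sup>2 / 8))\<^sup>2" .
qed simp

lemma norm_power_minus_one_le:
  fixes z :: "'a::real_normed_field"
  assumes "norm z = 1"
  shows "norm (z ^ n - 1) \<le> real n * norm (z - 1)"
proof -
  have "z ^ n - 1 = (z - 1) * (\<Sum>i<n. z ^ i)"
    by (rule power_diff_1_eq)
  moreover have "norm (\<Sum>i<n. z ^ i) \<le> real n"
    by (rule order_trans[OF norm_sum]) (simp add: norm_power assms)
  then have "norm (\<Sum>i<n. z ^ i) * norm (z - 1) \<le> real n * norm (z - 1)"
    by (rule mult_right_mono) simp
  ultimately show ?thesis
    by (simp add: norm_mult mult.commute)
qed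

text \<open>All powers of \<open>z\<close> below \<open>n\<close> have real part at least 1/2, so
  the geometric sum in the factorization of \<open>z ^ n - 1\<close> cannot cancel.\<close>

lemma norm_power_minus_one_ge:
  fixes z :: complex
  assumes "\<And>i. i < n \<Longrightarrow> cmod (z ^ i - 1) \<le> 1 / 2"
  shows "real n / 2 * cmod (z - 1) \<le> cmod (z ^ n - 1)"
proof -
  have "1 / 2 \<le> Re (z ^ i)" if "i < n" for i
    using abs_Re_le_cmod[of "z ^ i - 1"] assms[OF that] by simp
  then have "(\<Sum>i<n. 1 / 2) \<le> (\<Sum>i<n. Re (z ^ i))"
    by (intro sum_mono) simp
  then have "real n / 2 \<le> cmod (\<Sum>i<n. z ^ i)"
    using complex_Re_le_cmod[of "\<Sum>i<n. z ^ i"] by simp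
  then have "real n / 2 * cmod (z - 1) \<le> cmod (\<Sum>i<n. z ^ i) * cmod (z - 1)"
    by (rule mult_right_mono) simp
  moreover have "z ^ n - 1 = (z - 1) * (\<Sum>i<n. z ^ i)"
    by (rule power_diff_1_eq)
  ultimately show ?thesis
    by (simp add: norm_mult mult.commute)
qed

lemma sum_squares_ge_cube:
  "(\<Sum>j=1..n. (real j)\<^sup>2) \<ge> real n ^ 3 / 3"
proof (induction n)
  case (Suc n)
  have "real (Suc n) ^ 3 / 3 \<le> real n ^ 3 / 3 + (real (Suc n))\<^sup>2"
    by (simp add: power3_eq_cube power2_eq_square field_simps)
  with Suc show ?case by simp
qed simp

section \<open>Riesz products and IP-Dirichlet measures on the circle\<close>

lemma prod_one_plus_powi:
  fixes z :: complex
  assumes "finite A" "z \<noteq> 0"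
  shows "(\<Prod>k\<in>A. 1 + z powi n k) = (\<Sum>F\<in>Pow A. z powi (\<Sum>k\<in>F. n k))"
proof -
  have "(\<Prod>k\<in>F. z powi n k) = z powi (\<Sum>k\<in>F. n k)" if "finite F" for F
    using that by (induction F rule: finite_induct) (simp_all add: power_int_add assms)
  then show ?thesis
    using prod_add[OF assms(1), of "\<lambda>k. z powi n k" "\<lambda>_. 1"] assms(1)
    by (auto simp: add.commute intro!: sum.cong dest: finite_subset)
qed

lemma circle_prob_space: "circle_prob \<sigma> \<Longrightarrow> space \<sigma> = unit_circle"
  using sets_eq_imp_space_eq[of \<sigma> "restrict_space borel unit_circle"]
  by (simp add: circle_prob_def space_restrict_space)

lemma circle_prob_measurable_powi:
  assumes "circle_prob \<sigma>"
  shows "(\<lambda>z. z powi m) \<in> borel_measurable \<sigma>"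
proof -
  have "(\<lambda>z::complex. z powi m) \<in> borel_measurable (restrict_space borel unit_circle)"
    by (intro borel_measurable_continuous_on_restrict continuous_intros) auto
  with assms show ?thesis
    unfolding circle_prob_def by (metis measurable_cong_sets)
qed

lemma circle_prob_integrable_powi:
  assumes "circle_prob \<sigma>"
  shows "integrable \<sigma> (\<lambda>z. z powi m)"
proof -
  interpret prob_space \<sigma> using assms by (simp add: circle_prob_def)
  show ?thesis
    using circle_prob_measurable_powi[OF assms]
    by (intro integrable_const_bound[of _ 1])
       (auto simp: circle_prob_space[OF assms] norm_power_int)
qed

text \<open>A mean of numbers within 1/2 of 1 is itself within 1/2 of 1. The bound is uniform in
  \<open>A\<close>, so it can be contradicted later by letting \<open>A\<close> grow.\<close>

lemma IP_Dirichlet_Riesz_product_ge: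
  assumes \<sigma>: "circle_prob \<sigma>" and ip: "IP_Dirichlet \<sigma> n"
  obtains k0 where
    "\<And>A. finite A \<Longrightarrow> A \<subseteq> {k0..} \<Longrightarrow>
      1 / 2 \<le> (LINT z|\<sigma>. cmod (\<Prod>k\<in>A. (1 + z powi n k) / 2))"
proof -
  interpret prob_space \<sigma> using \<sigma> by (simp add: circle_prob_def)
  have nz: "z \<noteq> 0" if "z \<in> space \<sigma>" for z
    using that circle_prob_space[OF \<sigma>] by auto
  have "(0::real) < 1 / 2" by simp
  with ip obtain k1 where k1: "\<forall>F. finite F \<and> F \<noteq> {} \<and> F \<subseteq> {1..} \<and> k1 \<le> Min F \<longrightarrow>
      cmod (fourier_coeff \<sigma> (\<Sum>k\<in>F. n k) - 1) < 1 / 2"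
    unfolding IP_Dirichlet_def by presburger
  \<comment> \<open>Starting at \<open>max 1 k1\<close> keeps the index 0, about which
    \<open>IP_Dirichlet\<close> says nothing, out of \<open>A\<close>.\<close>
  have "1 / 2 \<le> (LINT z|\<sigma>. cmod (\<Prod>k\<in>A. (1 + z powi n k) / 2))"
    if A: "finite A" "A \<subseteq> {max 1 k1..}" for A
  proof -
    \<comment> \<open>The empty set lies outside the scope of \<open>IP_Dirichlet\<close>; its
      coefficient is the total mass 1.\<close>
    have close: "cmod (fourier_coeff \<sigma> (\<Sum>k\<in>F. n k) - 1) \<le> 1 / 2" if "F \<in> Pow A" for F
    proof (cases "F = {}")
      case True
      then show ?thesis by (simp add: fourier_coeff_def prob_space)
    next
      case False
      have F: "finite F" "F \<subseteq> {max 1 k1..}"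
        using that A finite_subset by auto
      have "F \<subseteq> {1..}" "k1 \<le> Min F"
        using F False by auto
      with F False k1 have "cmod (fourier_coeff \<sigma> (\<Sum>k\<in>F. n k) - 1) < 1 / 2" by blast
      then show ?thesis by (rule less_imp_le)
    qed
    have prod: "(\<Prod>k\<in>A. (1 + z powi n k) / 2) =
        (\<Sum>F\<in>Pow A. z powi (\<Sum>k\<in>F. n k)) / 2 ^ card A" if "z \<in> space \<sigma>" for z
      using prod_one_plus_powi[OF A(1) nz[OF that]] by (simp add: prod_dividef)
    have "(LINT z|\<sigma>. (\<Prod>k\<in>A. (1 + z powi n k) / 2)) =
        (LINT z|\<sigma>. (\<Sum>F\<in>Pow A. z powi (\<Sum>k\<in>F. n k)) / 2 ^ card A)"
      by (intro Bochner_Integration.integral_cong refl prod)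
    also have "\<dots> = (\<Sum>F\<in>Pow A. fourier_coeff \<sigma> (\<Sum>k\<in>F. n k)) / 2 ^ card A"
      using circle_prob_integrable_powi[OF \<sigma>] by (simp add: fourier_coeff_def)
    finally have eq: "(LINT z|\<sigma>. (\<Prod>k\<in>A. (1 + z powi n k) / 2)) =
        (\<Sum>F\<in>Pow A. fourier_coeff \<sigma> (\<Sum>k\<in>F. n k)) / 2 ^ card A" .
    \<comment> \<open>As \<open>A\<close> has \<open>2 ^ card A\<close> subsets, the 1 can be
      absorbed into the mean, which becomes a mean of deviations from 1.\<close>
    have "1 - (LINT z|\<sigma>. (\<Prod>k\<in>A. (1 + z powi n k) / 2)) =
        - (\<Sum>F\<in>Pow A. fourier_coeff \<sigma> (\<Sum>k\<in>F. n k) - 1) / 2 ^ card A"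
      unfolding eq using A(1) by (simp add: sum_subtractf card_Pow field_simps)
    then have "cmod (1 - (LINT z|\<sigma>. (\<Prod>k\<in>A. (1 + z powi n k) / 2))) =
        cmod (\<Sum>F\<in>Pow A. fourier_coeff \<sigma> (\<Sum>k\<in>F. n k) - 1) / 2 ^ card A"
      by (simp add: norm_divide norm_power)
    also have "\<dots> \<le> (\<Sum>F\<in>Pow A. 1 / 2) / 2 ^ card A"
      by (intro divide_right_mono sum_norm_le close) auto
    also have "\<dots> = 1 / 2"
      using A(1) by (simp add: card_Pow)
    finally have "cmod (1 - (LINT z|\<sigma>. (\<Prod>k\<in>A. (1 + z powi n k) / 2))) \<le> 1 / 2" .
    then have "1 / 2 \<le> cmod (LINT z|\<sigma>. (\<Prod>k\<in>A. (1 + z powi n k) / 2))"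
      using norm_triangle_ineq2[of 1 "1 - (LINT z|\<sigma>. (\<Prod>k\<in>A. (1 + z powi n k) / 2))"] by simp
    also have "\<dots> \<le> (LINT z|\<sigma>. cmod (\<Prod>k\<in>A. (1 + z powi n k) / 2))"
      by (rule integral_norm_bound)
    finally show ?thesis .
  qed
  then show thesis using that by blast
qed

lemma norm_Riesz_product_le_exp:
  assumes "finite A" "cmod z = 1"
  shows "cmod (\<Prod>k\<in>A. (1 + z powi n k) / 2) \<le> exp (- (\<Sum>k\<in>A. (cmod (z powi n k - 1))\<^sup>2) / 8)"
proof -
  have "cmod (\<Prod>k\<in>A. (1 + z powi n k) / 2) = (\<Prod>k\<in>A. cmod ((1 + z powi n k) / 2))"
    by (rule prod_norm[symmetric])
  also have "\<dots> \<le> (\<Prod>k\<in>A. exp (- (cmod (z powi n k - 1))\<^sup>2 / 8))"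
    using assms by (intro prod_mono conjI norm_ge_zero norm_one_plus_half_le_exp) (simp add: norm_power_int)
  also have "\<dots> = exp (- (\<Sum>k\<in>A. (cmod (z powi n k - 1))\<^sup>2) / 8)"
    using assms by (simp add: exp_sum[symmetric] sum_negf sum_divide_distrib)
  finally show ?thesis .
qed

text \<open>If the series diverged at every \<open>z \<noteq> 1\<close> of the circle, the Riesz
  products over \<open>{k0..<k0+N}\<close> would tend to 0 almost everywhere, and by dominated
  convergence their integrals would drop below 1/2.\<close>

lemma IP_Dirichlet_imp_summable:
  assumes \<sigma>: "circle_prob \<sigma>" and cont: "continuous_measure \<sigma>" and ip: "IP_Dirichlet \<sigma> n"
  shows "\<exists>z. cmod z = 1 \<and> z \<noteq> 1 \<and> summable (\<lambda>k. (cmod (z powi n k - 1))\<^sup>2)"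
proof (rule ccontr)
  assume no: "\<not> ?thesis"
  interpret prob_space \<sigma> using \<sigma> by (simp add: circle_prob_def)
  note sp = circle_prob_space[OF \<sigma>]
  obtain k0 where k0: "\<And>A. finite A \<Longrightarrow> A \<subseteq> {k0..} \<Longrightarrow>
      1 / 2 \<le> (LINT z|\<sigma>. cmod (\<Prod>k\<in>A. (1 + z powi n k) / 2))"
    using IP_Dirichlet_Riesz_product_ge[OF \<sigma> ip] by blast
  define P where "P N z = cmod (\<Prod>k\<in>{k0..<k0+N}. (1 + z powi n k) / 2)" for N z
  have conv: "(\<lambda>N. P N z) \<longlonglongrightarrow> 0" if z: "z \<in> unit_circle" "z \<noteq> 1" for z
  proof -
    let ?d = "\<lambda>k. (cmod (z powi n (k + k0) - 1))\<^sup>2"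
    have "\<not> summable (\<lambda>k. (cmod (z powi n k - 1))\<^sup>2)"
      using no z by auto
    then have "\<not> summable ?d"
      using summable_iff_shift[of "\<lambda>k. (cmod (z powi n k - 1))\<^sup>2" k0] by simp
    then have "filterlim (\<lambda>N. \<Sum>k<N. ?d k) at_top sequentially"
      by (rule not_summable_imp_filterlim_at_top) simp
    then have "filterlim (\<lambda>N. - 1 / 8 * (\<Sum>k<N. ?d k)) at_bot sequentially"
      by (intro filterlim_tendsto_neg_mult_at_bot[OF tendsto_const]) auto
    then have "(\<lambda>N. exp (- (\<Sum>k<N. ?d k) / 8)) \<longlonglongrightarrow> 0"
      using filterlim_compose[OF exp_at_bot] by simp
    moreover have "P N z \<le> exp (- (\<Sum>k<N. ?d k) / 8)" for N
    proof -
      have "(\<Sum>k\<in>{k0..<k0+N}. (cmod (z powi n k - 1))\<^sup>2) = (\<Sum>k<N. ?d k)"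
        using sum.shift_bounds_nat_ivl[of "\<lambda>k. (cmod (z powi n k - 1))\<^sup>2" 0 k0 N]
        by (simp add: add.commute lessThan_atLeast0)
      then show ?thesis
        using norm_Riesz_product_le_exp[of "{k0..<k0+N}" z n] z by (simp add: P_def)
    qed
    ultimately show ?thesis
      by (intro tendsto_sandwich[of "\<lambda>_. 0" "\<lambda>N. P N z" _ "\<lambda>N. exp (- (\<Sum>k<N. ?d k) / 8)"])
         (simp_all add: P_def)
  qed
  have "(\<lambda>N. LINT z|\<sigma>. P N z) \<longlonglongrightarrow> (LINT z|\<sigma>. 0)"
  proof (rule integral_dominated_convergence[where w = "\<lambda>_. 1"])
    \<comment> \<open>Every product equals 1 at the point 1, so this point has to be discarded as a
      null set.\<close>
    have "1 \<in> space \<sigma>" by (simp add: sp)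
    then have "emeasure \<sigma> {1} = 0" using cont by (simp add: continuous_measure_def)
    moreover have "{1} \<in> sets \<sigma>"
      using \<sigma> by (auto simp: circle_prob_def sets_restrict_space)
    ultimately have "AE z in \<sigma>. z \<noteq> 1"
      by (intro AE_I'[of "{1}"]) auto
    then show "AE z in \<sigma>. (\<lambda>N. P N z) \<longlonglongrightarrow> 0"
      using AE_space by eventually_elim (use conv sp in auto)
    show "AE z in \<sigma>. norm (P N z) \<le> 1" for N
    proof (rule AE_I2)
      fix z assume "z \<in> space \<sigma>"
      then have "P N z \<le> exp (- (\<Sum>k\<in>{k0..<k0+N}. (cmod (z powi n k - 1))\<^sup>2) / 8)"
        unfolding P_def using sp by (intro norm_Riesz_product_le_exp) auto
      also have "\<dots> \<le> 1" by (simp add: sum_nonneg)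
      finally show "norm (P N z) \<le> 1" by (simp add: P_def)
    qed
    show "P N \<in> borel_measurable \<sigma>" for N
      unfolding P_def using circle_prob_measurable_powi[OF \<sigma>] by measurable
  qed auto
  moreover have "1 / 2 \<le> (LINT z|\<sigma>. P N z)" for N
    unfolding P_def by (rule k0) auto
  ultimately have "(1 / 2 :: real) \<le> 0"
    by (intro LIMSEQ_le_const[of "\<lambda>N. LINT z|\<sigma>. P N z"]) auto
  then show False by simp
qed

section \<open>The blocks of multiples of \<open>p l\<close>\<close>

text \<open>By \<open>norm_power_minus_one_ge\<close> the term of index \<open>j\<close> is at least
  \<open>(real j)\<^sup>2 / 4\<close> times \<open>(cmod (w - 1))\<^sup>2\<close>; the sum of
  squares contributes the cube over 3, hence the 12. The intended \<open>w\<close> is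
  \<open>z powi p l\<close>.\<close>

lemma block_sum_ge:
  fixes w :: complex and r :: int
  assumes "\<And>j. j \<in> {1..r} \<Longrightarrow> cmod (w powi j - 1) \<le> 1 / 2" and "0 \<le> r"
  shows "(real_of_int r) ^ 3 / 12 * (cmod (w - 1))\<^sup>2 \<le> (\<Sum>j\<in>{1..r}. (cmod (w powi j - 1))\<^sup>2)"
proof -
  define m where "m = nat r"
  have r: "r = int m" using assms(2) by (simp add: m_def)
  have small: "cmod (w ^ i - 1) \<le> 1 / 2" if "i \<le> m" for i
    using assms(1)[of "int i"] that by (cases "i = 0") (simp_all add: r)
  have "real m ^ 3 / 12 * (cmod (w - 1))\<^sup>2 \<le> (\<Sum>j=1..m. (real j)\<^sup>2) * ((cmod (w - 1))\<^sup>2 / 4)"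
    using mult_right_mono[OF sum_squares_ge_cube[of m], of "(cmod (w - 1))\<^sup>2 / 4"] by simp
  also have "\<dots> = (\<Sum>j=1..m. (real j / 2 * cmod (w - 1))\<^sup>2)"
    by (simp add: sum_distrib_right power_mult_distrib power_divide)
  also have "\<dots> \<le> (\<Sum>j=1..m. (cmod (w ^ j - 1))\<^sup>2)"
    by (intro sum_mono power_mono norm_power_minus_one_ge small) auto
  also have "\<dots> = (\<Sum>j\<in>{1..r}. (cmod (w powi j - 1))\<^sup>2)"
    by (rule sum.reindex_bij_witness[of _ nat int]) (auto simp: r)
  finally show ?thesis by (simp add: r)
qed

text \<open>Since \<open>\<gamma> < 1 \<le> r\<close>, the quotient
  \<open>(real_of_int r)\<^sup>2 / \<gamma>\<close> is at least the integer \<open>r\<close>, and so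
  is its floor. The final summand 1 makes the inequality strict.\<close>

lemma block_step:
  fixes \<gamma> :: real and r p q :: int
  assumes "0 < \<gamma>" "\<gamma> < 1" "1 \<le> r" "1 \<le> p" "q = \<lfloor>(real_of_int r)\<^sup>2 / \<gamma>\<rfloor> * p + 1"
  shows "r * p < q"
proof -
  have "real_of_int r * \<gamma> \<le> real_of_int r * real_of_int r"
    using assms by (intro mult_left_mono) auto
  then have "r \<le> \<lfloor>(real_of_int r)\<^sup>2 / \<gamma>\<rfloor>"
    using assms by (simp add: le_floor_iff power2_eq_square field_simps)
  then have "r * p \<le> \<lfloor>(real_of_int r)\<^sup>2 / \<gamma>\<rfloor> * p"
    using assms by (intro mult_right_mono) auto
  with assms show ?thesis by simp
qed

text \<open>The growth hypothesis is conditional on \<open>1 \<le> p l\<close> because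
  \<open>block_step\<close> asks for positivity; the induction supplies it along the way. The linear
  bound pushes the blocks to infinity.\<close>

lemma block_pos:
  fixes r p :: "nat \<Rightarrow> int"
  assumes "p 1 = 1" "\<And>l. 1 \<le> l \<Longrightarrow> 1 \<le> p l \<Longrightarrow> r l * p l < p (l + 1)" "\<And>l. 1 \<le> l \<Longrightarrow> 1 \<le> r l" "1 \<le> l"
  shows "int l \<le> p l"
  using assms(4)
proof (induction l rule: dec_induct)
  case (step l)
  have "1 * p l \<le> r l * p l"
    using step assms(3)[of l] by (intro mult_right_mono) auto
  also have "\<dots> < p (l + 1)"
    using step by (intro assms(2)) auto
  finally show ?case using step by simp
qed (use assms(1) in simp)

text \<open>Block \<open>l\<close> lies between \<open>p l\<close> and \<open>r l * p l\<close>, and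
  by \<open>lt\<close> these intervals follow one another without overlap. Within a block the
  positive factor \<open>p l\<close> cancels.\<close>

lemma block_inj:
  fixes r p :: "nat \<Rightarrow> int"
  assumes lt: "\<And>l. 1 \<le> l \<Longrightarrow> r l * p l < p (l + 1)"
    and r: "\<And>l. 1 \<le> l \<Longrightarrow> 1 \<le> r l" and p: "\<And>l. 1 \<le> l \<Longrightarrow> 1 \<le> p l"
  shows "inj_on (\<lambda>(l, j). j * p l) (SIGMA l:{1..}. {1..r l})"
proof -
  have sep: "r l * p l < p l'" if "1 \<le> l" "l < l'" for l l'
  proof -
    from that have "Suc l \<le> l'" by simp
    then show ?thesis
    proof (induction l' rule: dec_induct)
      case (step k)
      have "1 * p k \<le> r k * p k"
        using step that r[of k] p[of k] by (intro mult_right_mono) auto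
      with step lt[of k] that show ?case by simp
    qed (use lt that in simp)
  qed
  have ne: "j * p l \<noteq> j' * p l'"
    if "1 \<le> l" "l < l'" "j \<le> r l" "1 \<le> j'" for l l' j j'
  proof -
    have "j * p l \<le> r l * p l"
      using that p[of l] by (intro mult_right_mono) auto
    also have "\<dots> < p l'" using that by (intro sep)
    also have "\<dots> = 1 * p l'" by simp
    also have "\<dots> \<le> j' * p l'"
      using that p[of l'] by (intro mult_right_mono) auto
    finally show ?thesis by simp
  qed
  show ?thesis
  proof (rule inj_onI, clarsimp)
    fix l j l' j'
    assume h: "Suc 0 \<le> l" "Suc 0 \<le> l'" "1 \<le> j" "j \<le> r l" "1 \<le> j'" "j' \<le> r l'" "j * p l = j' * p l'"
    have "l = l'"
      using ne[of l l' j j'] ne[of l' l j' j] h by (cases l l' rule: linorder_cases) auto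
    with h p[of l] show "l = l' \<and> j = j'" by auto
  qed
qed

text \<open>The threshold concerns the value \<open>m\<close> and not its index, so that a multiple
  \<open>j * p l\<close> is controlled by its size, without locating it in the enumeration
  \<open>n\<close>.\<close>

lemma summable_imp_small_off_bounded:
  fixes n :: "nat \<Rightarrow> int"
  assumes "summable (\<lambda>k. (cmod (z powi n k - 1))\<^sup>2)" "0 < \<epsilon>"
  obtains M where "\<And>m. m \<in> range n \<Longrightarrow> M < m \<Longrightarrow> cmod (z powi m - 1) \<le> \<epsilon>"
proof -
  have "\<forall>\<^sub>F k in sequentially. (cmod (z powi n k - 1))\<^sup>2 < \<epsilon>\<^sup>2"
    using assms(2) by (intro order_tendstoD(2)[OF summable_LIMSEQ_zero[OF assms(1)]]) simp
  then obtain N where N: "\<And>k. N \<le> k \<Longrightarrow> (cmod (z powi n k - 1))\<^sup>2 < \<epsilon>\<^sup>2"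
    unfolding eventually_sequentially by blast
  \<comment> \<open>A value above the maximum over the indices up to \<open>N\<close> must have an
    index beyond \<open>N\<close>; this also takes care of the arbitrary value
    \<open>n 0\<close>.\<close>
  have "cmod (z powi m - 1) \<le> \<epsilon>" if m: "m \<in> range n" "Max (n ` {..N}) < m" for m
  proof -
    obtain k where k: "m = n k" using m by auto
    have "\<not> k \<le> N"
      using m(2) k by (auto simp: not_less[symmetric])
    then have "(cmod (z powi m - 1))\<^sup>2 < \<epsilon>\<^sup>2"
      unfolding k by (intro N) simp
    then show ?thesis
      using assms(2) by (meson less_imp_le power2_less_imp_less)
  qed
  then show thesis using that by blast
qed

text \<open>Nonnegative terms are summable in any order, so the series is reindexed by the values of
  \<open>n\<close>, then by the pairs \<open>(l, j)\<close>, and finally summed over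
  \<open>j\<close> in each block. Injectivity ensures that no value is counted twice.\<close>

lemma summable_blocks:
  fixes n r p :: "_ \<Rightarrow> int" and f :: "int \<Rightarrow> real"
  assumes "summable (\<lambda>k. f (n k))" "\<And>m. 0 \<le> f m" "inj_on n {1..}"
    and "n ` {1..} = (\<Union>l\<in>{1..}. (\<lambda>j. j * p l) ` {1..r l})"
    and "inj_on (\<lambda>(l, j). j * p l) (SIGMA l:{1..}. {1..r l})"
  shows "summable (\<lambda>l. \<Sum>j\<in>{1..r (l + 1)}. f (j * p (l + 1)))"
proof -
  have "(\<lambda>k. f (n k)) summable_on UNIV"
    using assms by (simp add: summable_on_UNIV_nonneg_real_iff)
  then have "(\<lambda>k. f (n k)) summable_on {1..}"
    by (rule summable_on_subset_banach) simp
  then have "f summable_on n ` {1..}"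
    using summable_on_reindex[OF assms(3), of f] by (simp only: o_def)
  also have "n ` {1..} = (\<lambda>(l, j). j * p l) ` (SIGMA l:{1..}. {1..r l})"
    unfolding assms(4) by force
  finally have "(\<lambda>(l, j). f (j * p l)) summable_on (SIGMA l:{1..}. {1..r l})"
    using summable_on_reindex[OF assms(5), of f] by (simp only: o_def case_prod_unfold)
  then have "(\<lambda>l. \<Sum>j\<in>{1..r l}. f (j * p l)) summable_on {1..}"
    using summable_on_Sigma_banach[of "\<lambda>l j. f (j * p l)" "{1..}" "\<lambda>l. {1..r l}"] by simp
  then have "(\<lambda>l. \<Sum>j\<in>{1..r l}. f (j * p l)) summable_on range Suc"
    by (rule summable_on_subset_banach) auto
  then have "(\<lambda>l. \<Sum>j\<in>{1..r (l + 1)}. f (j * p (l + 1))) summable_on UNIV"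
    using summable_on_reindex[of Suc UNIV "\<lambda>l. \<Sum>j\<in>{1..r l}. f (j * p l)"]
    by (simp add: o_def)
  then show ?thesis by (rule summable_on_imp_summable)
qed

text \<open>Let \<open>w = z powi p\<close> and let \<open>a\<close> be the floor. As
  \<open>w ^ a * z\<close> is close to 1, \<open>w ^ a\<close> stays at distance at least
  \<open>cmod (z - 1) / 2\<close> from 1; this distance is at most \<open>a * cmod (w - 1)\<close>,
  so \<open>w\<close> cannot be too close to 1.\<close>

lemma norm_powi_minus_one_lower:
  fixes z :: complex and \<gamma> :: real and r p :: int
  assumes z: "cmod z = 1" and \<gamma>: "0 < \<gamma>" and r: "1 \<le> r"
    and small: "cmod (z powi (\<lfloor>(real_of_int r)\<^sup>2 / \<gamma>\<rfloor> * p + 1) - 1) \<le> cmod (z - 1) / 2"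
  shows "(cmod (z - 1))\<^sup>2 / 48 * (\<gamma>\<^sup>2 / real_of_int r) \<le>
    (real_of_int r) ^ 3 / 12 * (cmod (z powi p - 1))\<^sup>2"
proof -
  define w where "w = z powi p"
  define a where "a = nat \<lfloor>(real_of_int r)\<^sup>2 / \<gamma>\<rfloor>"
  have a: "\<lfloor>(real_of_int r)\<^sup>2 / \<gamma>\<rfloor> = int a" "real a \<le> (real_of_int r)\<^sup>2 / \<gamma>"
    using \<gamma> by (simp_all add: a_def)
  have z0: "z \<noteq> 0" using z by auto
  have w: "cmod w = 1" using z by (simp add: w_def norm_power_int)
  have "z powi (int a * p + 1) = w ^ a * z"
    using z0 by (simp add: w_def power_int_add power_int_mult mult.commute[of "int a"])
  then have "cmod (w ^ a * z - 1) \<le> cmod (z - 1) / 2"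
    using small by (simp add: a)
  moreover have "cmod (z - 1) \<le> cmod (w ^ a * z - 1) + cmod (w ^ a - 1)"
  proof -
    have "z - 1 = (w ^ a * z - 1) - (w ^ a - 1) * z" by (simp add: algebra_simps)
    then have "cmod (z - 1) \<le> cmod (w ^ a * z - 1) + cmod ((w ^ a - 1) * z)"
      by (metis norm_triangle_ineq4)
    then show ?thesis by (simp add: norm_mult z)
  qed
  moreover have "cmod (w ^ a - 1) \<le> real a * cmod (w - 1)"
    using w by (rule norm_power_minus_one_le)
  moreover have "real a * cmod (w - 1) \<le> (real_of_int r)\<^sup>2 / \<gamma> * cmod (w - 1)"
    using a by (intro mult_right_mono) auto
  ultimately have "cmod (z - 1) / 2 \<le> (real_of_int r)\<^sup>2 / \<gamma> * cmod (w - 1)"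
    by linarith
  then have "cmod (z - 1) / 2 * \<gamma> \<le> (real_of_int r)\<^sup>2 * cmod (w - 1)"
    using \<gamma> by (simp add: field_simps)
  then have "(cmod (z - 1) / 2 * \<gamma>)\<^sup>2 \<le> ((real_of_int r)\<^sup>2 * cmod (w - 1))\<^sup>2"
    using \<gamma> by (intro power_mono) auto
  \<comment> \<open>Dividing by \<open>12 * r\<close> turns \<open>r ^ 4\<close> into the factor
    \<open>r ^ 3 / 12\<close> of \<open>block_sum_ge\<close>, and 1/4 into 1/48.\<close>
  then have "(cmod (z - 1))\<^sup>2 * \<gamma>\<^sup>2 / 4 / (12 * real_of_int r) \<le>
      (real_of_int r) ^ 4 * (cmod (w - 1))\<^sup>2 / (12 * real_of_int r)"
    using r by (intro divide_right_mono) (auto simp: power_mult_distrib power_divide)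
  then show ?thesis
    using r by (simp add: w_def power4_eq_xxxx power3_eq_cube)
qed

section \<open>Convergent block sums against the divergence of the series of
  \<open>(\<gamma> l)\<^sup>2 / r l\<close>\<close>

theorem proposition4p2:
  fixes \<gamma> :: "nat \<Rightarrow> real" and r p :: "nat \<Rightarrow> int"
  assumes "\<forall>l\<ge>1. 0 < \<gamma> l \<and> \<gamma> l < 1"
    and "\<gamma> \<longlonglongrightarrow> 0"
    and "\<not> summable (\<lambda>l. (\<gamma> (l + 1))\<^sup>2)"
    and "\<forall>l\<ge>1. r l \<ge> 2"
    and "filterlim r at_top sequentially"
    and "\<not> summable (\<lambda>l. (\<gamma> (l + 1))\<^sup>2 / real_of_int (r (l + 1)))"
    and "p 1 = 1"
    and "\<forall>l\<ge>1. p (l + 1) = \<lfloor>(real_of_int (r l))\<^sup>2 / \<gamma> l\<rfloor> * p l + 1"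
  shows "(\<forall>l\<ge>1. p (l + 1) > r l * p l) \<and>
    (\<forall>n :: nat \<Rightarrow> int.
       strict_mono_on {1..} n \<and>
       n ` {1..} = (\<Union>l\<in>{1..}. (\<lambda>j. j * p l) ` {1..r l}) \<longrightarrow>
       \<not> (\<exists>\<sigma>. circle_prob \<sigma> \<and> continuous_measure \<sigma> \<and> IP_Dirichlet \<sigma> n))"
proof -
  have \<gamma>: "0 < \<gamma> l" "\<gamma> l < 1" and r1: "1 \<le> r l"
    and p_rec: "p (l + 1) = \<lfloor>(real_of_int (r l))\<^sup>2 / \<gamma> l\<rfloor> * p l + 1" if "1 \<le> l" for l
    using assms(1,4,8) that by force+
  have step: "r l * p l < p (l + 1)" if "1 \<le> l" "1 \<le> p l" for l
    using that \<gamma> r1 p_rec by (intro block_step[of "\<gamma> l"]) auto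
  have p_ge: "int l \<le> p l" if "1 \<le> l" for l
    using assms(7) step r1 that by (rule block_pos)
  have p1: "1 \<le> p l" if "1 \<le> l" for l
    using p_ge[OF that] that by linarith
  have lt: "r l * p l < p (l + 1)" if "1 \<le> l" for l
    using that by (intro step p1)
  have no_measure: False
    if mono: "strict_mono_on {1..} n"
      and range: "n ` {1..} = (\<Union>l\<in>{1..}. (\<lambda>j. j * p l) ` {1..r l})"
      and \<sigma>: "circle_prob \<sigma>" "continuous_measure \<sigma>" "IP_Dirichlet \<sigma> n" for n \<sigma>
  proof -
    obtain z where z: "cmod z = 1" "z \<noteq> 1"
      and sum: "summable (\<lambda>k. (cmod (z powi n k - 1))\<^sup>2)"
      using IP_Dirichlet_imp_summable[OF \<sigma>] by blast
    \<comment> \<open>The bound 1/2 serves \<open>block_sum_ge\<close>, the bound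
      \<open>cmod (z - 1) / 2\<close> serves \<open>norm_powi_minus_one_lower\<close>.\<close>
    define \<epsilon> where "\<epsilon> = min (1 / 2) (cmod (z - 1) / 2)"
    have "0 < \<epsilon>" using z by (simp add: \<epsilon>_def)
    then obtain M where M: "\<And>m. m \<in> range n \<Longrightarrow> M < m \<Longrightarrow> cmod (z powi m - 1) \<le> \<epsilon>"
      using summable_imp_small_off_bounded[OF sum] by blast
    \<comment> \<open>Since \<open>p l\<close> is at least \<open>l\<close>, all elements of a block
      with \<open>l\<close> beyond \<open>M\<close> exceed \<open>M\<close>.\<close>
    have small: "cmod (z powi (j * p l) - 1) \<le> \<epsilon>"
      if "1 \<le> l" "M < int l" "j \<in> {1..r l}" for j l
    proof (rule M)
      have "j * p l \<in> n ` {1..}" unfolding range using that by (intro UN_I[of l] imageI) auto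
      then show "j * p l \<in> range n" by auto
      have "1 * p l \<le> j * p l"
        using that p1[of l] by (intro mult_right_mono) auto
      then show "M < j * p l" using that p_ge[of l] by linarith
    qed
    let ?B = "\<lambda>l. \<Sum>j\<in>{1..r l}. (cmod (z powi (j * p l) - 1))\<^sup>2"
    have "summable (\<lambda>l. ?B (l + 1))"
      using strict_mono_on_imp_inj_on[OF mono]
      by (intro summable_blocks[OF sum _ _ range] block_inj lt r1 p1) auto
    moreover have "(cmod (z - 1))\<^sup>2 / 48 * ((\<gamma> l)\<^sup>2 / real_of_int (r l)) \<le> ?B l"
      if l: "1 \<le> l" "M < int l" for l
    proof -
      have pow: "(z powi p l) powi j = z powi (j * p l)" for j
        by (simp only: power_int_mult mult.commute[of j])
      \<comment> \<open>The first element of the next block is \<open>p (l + 1)\<close>, exactly the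
        exponent that the recursion produces from \<open>p l\<close>.\<close>
      have "cmod (z powi (1 * p (l + 1)) - 1) \<le> \<epsilon>"
        using l r1[of "l + 1"] by (intro small) auto
      then have "(cmod (z - 1))\<^sup>2 / 48 * ((\<gamma> l)\<^sup>2 / real_of_int (r l)) \<le>
          (real_of_int (r l)) ^ 3 / 12 * (cmod (z powi p l - 1))\<^sup>2"
        using l z \<gamma> r1 p_rec[OF l(1)] by (intro norm_powi_minus_one_lower) (simp_all add: \<epsilon>_def)
      also have "\<dots> \<le> (\<Sum>j\<in>{1..r l}. (cmod ((z powi p l) powi j - 1))\<^sup>2)"
        using small[OF l] r1[OF l(1)] by (intro block_sum_ge) (simp_all add: \<epsilon>_def pow)
      also have "\<dots> = ?B l"
        by (simp only: pow)
      finally show ?thesis .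
    qed
    \<comment> \<open>After the shift by one, \<open>nat M \<le> l\<close> suffices for
      \<open>M < int (l + 1)\<close>.\<close>
    then have "norm ((cmod (z - 1))\<^sup>2 / 48 * ((\<gamma> (l + 1))\<^sup>2 / real_of_int (r (l + 1)))) \<le> ?B (l + 1)"
      if "nat M \<le> l" for l
      using that r1[of "l + 1"] by (subst real_norm_def, subst abs_of_nonneg) auto
    ultimately have "summable (\<lambda>l. (cmod (z - 1))\<^sup>2 / 48 * ((\<gamma> (l + 1))\<^sup>2 / real_of_int (r (l + 1))))"
      by (rule summable_comparison_test')
    then show False
      using z assms(6) by (subst (asm) summable_cmult_iff) auto
  qed
  show ?thesis
    by (intro conjI allI impI notI; (elim conjE exE)?) (rule lt no_measure; assumption)+
qed

end
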